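(* Let $\lambda_\infty^{\mathrm{known}}$ be the rational number whose decimal expansion is $0.d_1d_2\cdots d_{500}$ with the 500 digits listed in the context. Assume that $$|h(\lambda_\infty^{\mathrm{known}})-1|\le 10^{-500.17}.$$ Then all 500 decimal digits of $\lambda_\infty^{\mathrm{known}}$ are correct as digits of $\lambda_\infty$, in the sense that $|\lambda_\infty^{\mathrm{known}}-\lambda_\infty|<5\times10^{-501}$.
   Context: For $x\in\bigl(\tfrac14,+\infty\bigr)$, $h(x)=\sum_{p\text{ prime}}\frac{1}{xp^2-p+1}$. The constant $\lambda_\infty$ is the unique solution of $h(x)=1$ in $\bigl(\tfrac14,+\infty\bigr)$. The 500 digits $d_1d_2\cdots d_{500}$ after the decimal point are the following, read row by row (50 digits per row, spaces to be ignored): 6740361831 9369613993 6660007576 5084557806 4568836207 8994244674 1754883881 7401708236 1693874191 5608494422 7398749905 7041831822 5195439203 9562901979 2688341765 0411758277 6752512712 7956851493 5586461755 9840474823 7892101249 4845493888 1287449392 8354168321 2062529552 6393853915 8259887398 1662423751 8719899836 7771139286 9475591906 2611878087 9227561767 4951179032 4455092710 7519963900 4061335349 9258822111 8673838784 2562146167 5868417863 3751233764 5258937879 8594801278 0664426851 7740348910 6684845932 6094838543 0516617873 7522888393 *)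

theory Defs
  imports "HOL-Analysis.Infinite_Sum" "HOL-Computational_Algebra.Primes"
begin

text \<open>On the domain of interest, \<open>x > 1/4\<close>, every denominator is positive and the
  sum converges; elsewhere the value is irrelevant.\<close>

definition h :: "real \<Rightarrow> real" where
  "h x = (\<Sum>\<^sub>\<infinity>p\<in>{p::nat. prime p}. 1 / (x * (real p)\<^sup>2 - real p + 1))"

definition lambda_infty :: real where
  "lambda_infty = (THE x. x \<in> {1/4<..} \<and> h x = 1)"

definition known_digits :: "nat list" where
  "known_digits =
    [6,7,4,0,3,6,1,8,3,1, 9,3,6,9,6,1,3,9,9,3, 6,6,6,0,0,0,7,5,7,6, 5,0,8,4,5,5,7,8,0,6, 4,5,6,8,8,3,6,2,0,7,
     8,9,9,4,2,4,4,6,7,4, 1,7,5,4,8,8,3,8,8,1, 7,4,0,1,7,0,8,2,3,6, 1,6,9,3,8,7,4,1,9,1, 5,6,0,8,4,9,4,4,2,2,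
     7,3,9,8,7,4,9,9,0,5, 7,0,4,1,8,3,1,8,2,2, 5,1,9,5,4,3,9,2,0,3, 9,5,6,2,9,0,1,9,7,9, 2,6,8,8,3,4,1,7,6,5,
     0,4,1,1,7,5,8,2,7,7, 6,7,5,2,5,1,2,7,1,2, 7,9,5,6,8,5,1,4,9,3, 5,5,8,6,4,6,1,7,5,5, 9,8,4,0,4,7,4,8,2,3,
     7,8,9,2,1,0,1,2,4,9, 4,8,4,5,4,9,3,8,8,8, 1,2,8,7,4,4,9,3,9,2, 8,3,5,4,1,6,8,3,2,1, 2,0,6,2,5,2,9,5,5,2,
     6,3,9,3,8,5,3,9,1,5, 8,2,5,9,8,8,7,3,9,8, 1,6,6,2,4,2,3,7,5,1, 8,7,1,9,8,9,9,8,3,6, 7,7,7,1,1,3,9,2,8,6,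
     9,4,7,5,5,9,1,9,0,6, 2,6,1,1,8,7,8,0,8,7, 9,2,2,7,5,6,1,7,6,7, 4,9,5,1,1,7,9,0,3,2, 4,4,5,5,0,9,2,7,1,0,
     7,5,1,9,9,6,3,9,0,0, 4,0,6,1,3,3,5,3,4,9, 9,2,5,8,8,2,2,1,1,1, 8,6,7,3,8,3,8,7,8,4, 2,5,6,2,1,4,6,1,6,7,
     5,8,6,8,4,1,7,8,6,3, 3,7,5,1,2,3,3,7,6,4, 5,2,5,8,9,3,7,8,7,9, 8,5,9,4,8,0,1,2,7,8, 0,6,6,4,4,2,6,8,5,1,
     7,7,4,0,3,4,8,9,1,0, 6,6,8,4,8,4,5,9,3,2, 6,0,9,4,8,3,8,5,4,3, 0,5,1,6,6,1,7,8,7,3, 7,5,2,2,8,8,8,3,9,3]"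

lemma known_digits_decimal:
  "length known_digits = 500" "\<forall>d\<in>set known_digits. d \<le> 9"
  by (simp_all add: known_digits_def)

text \<open>List positions start at 0, so the entry at position \<open>i\<close> is the digit of weight
  \<open>10 ^ -(i + 1)\<close>.\<close>

definition lambda_known :: real where
  "lambda_known = (\<Sum>i<500. real (known_digits ! i) / 10 ^ (i + 1))"

end

theory Submission
  imports Defs "HOL-Analysis.Lipschitz" "HOL-Analysis.Summation_Tests"
begin

text \<open>The idea is that a small residual \<open>h x - 1\<close> forces \<open>x\<close> to be close to the root, because \<open>h\<close>
  is steep there. Subtracting the series termwise gives
  \<open>h x - h y = (y - x) * (\<Sum>\<^sub>\<infinity>p. p\<^sup>2 / ((x p\<^sup>2 - p + 1) (y p\<^sup>2 - p + 1)))\<close>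
  with positive terms (\<open>h_diff\<close>). Bounding the sum above by a multiple of \<open>\<Sum>\<^sub>\<infinity>p. 1 / p\<^sup>2\<close> shows
  that \<open>h\<close> is Lipschitz on every half-line \<open>[a, \<infinity>)\<close> with \<open>a > 1/4\<close> (\<open>continuous_on_h\<close>); bounding
  it below by the single term \<open>p = 2\<close> gives strict monotonicity and a quantitative lower bound for
  the decrease of \<open>h\<close> (\<open>h_secant_ge\<close>).

  For arguments up to \<open>0.676\<close> the prime \<open>2\<close> alone contributes a slope of absolute value at least
  \<open>4 / (4 * 0.676 - 1)\<^sup>2 > 1.377\<close>, so moving by \<open>5 * 10 powr (- 501)\<close> changes \<open>h\<close> by more than
  \<open>6.88 * 10 powr (- 501)\<close>, whereas the residual is at most
  \<open>10 powr (- 500.17) < 6.88 * 10 powr (- 501)\<close>. Hence \<open>h - 1\<close> has opposite strict signs at the two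
  ends of the interval of that radius around the known value, and the intermediate value theorem
  puts the unique root strictly inside (\<open>lambda_infty_close\<close>).\<close>

text \<open>The difference of the two sides is \<open>(p/2 - 1)\<^sup>2\<close>; this is where the threshold \<open>1/4\<close> comes
  from.\<close>

lemma denominator_ge:
  fixes x p :: real
  shows "(x - 1/4) * p\<^sup>2 \<le> x * p\<^sup>2 - p + 1"
proof -
  have "x * p\<^sup>2 - p + 1 - (x - 1/4) * p\<^sup>2 = (p/2 - 1)\<^sup>2"
    by (simp add: power2_eq_square algebra_simps)
  then show ?thesis
    using zero_le_power2[of "p/2 - 1"] by linarith
qed

lemma denominator_pos:
  assumes "1/4 < x" "prime (p::nat)"
  shows "0 < x * (real p)\<^sup>2 - real p + 1"
proof -
  have "0 < (x - 1/4) * (real p)\<^sup>2"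
    using assms prime_gt_0_nat[of p] by simp
  then show ?thesis
    using denominator_ge[of x "real p"] by linarith
qed

lemma inverse_squares_summable_on:
  "(\<lambda>n::nat. 1 / (real n)\<^sup>2) summable_on A"
proof -
  have "summable (\<lambda>n. norm (1 / (real n)\<^sup>2))"
    using inverse_power_summable[of 2, where 'a = real] by (simp add: inverse_eq_divide)
  then have "(\<lambda>n::nat. 1 / (real n)\<^sup>2) summable_on UNIV"
    by (rule norm_summable_imp_summable_on)
  then show ?thesis
    by (rule summable_on_subset_banach) simp
qed

lemma h_term_le:
  assumes "1/4 < x" "prime (p::nat)"
  shows "1 / (x * (real p)\<^sup>2 - real p + 1) \<le> 1 / (x - 1/4) * (1 / (real p)\<^sup>2)"
proof -
  have "0 < (x - 1/4) * (real p)\<^sup>2"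
    using assms prime_gt_0_nat[of p] by simp
  then have "1 / (x * (real p)\<^sup>2 - real p + 1) \<le> 1 / ((x - 1/4) * (real p)\<^sup>2)"
    using denominator_ge[of x "real p"] by (intro divide_left_mono) auto
  then show ?thesis by simp
qed

lemma h_summable:
  assumes "1/4 < x"
  shows "(\<lambda>p::nat. 1 / (x * (real p)\<^sup>2 - real p + 1)) summable_on {p. prime p}"
proof (rule summable_on_comparison_test)
  show "(\<lambda>p::nat. 1 / (x - 1/4) * (1 / (real p)\<^sup>2)) summable_on {p. prime p}"
    by (intro summable_on_cmult_right inverse_squares_summable_on)
next
  fix p :: nat
  assume "p \<in> {p. prime p}"
  then have p: "prime p" by simp
  show "1 / (x * (real p)\<^sup>2 - real p + 1) \<le> 1 / (x - 1/4) * (1 / (real p)\<^sup>2)"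
    by (rule h_term_le[OF assms p])
  show "0 \<le> 1 / (x * (real p)\<^sup>2 - real p + 1)"
    using denominator_pos[OF assms p] by simp
qed

text \<open>The absolute value of the slope of \<open>p\<close>'s contribution to \<open>h\<close> along the secant from \<open>x\<close> to
  \<open>y\<close>.\<close>

definition secant_term :: "real \<Rightarrow> real \<Rightarrow> nat \<Rightarrow> real" where
  "secant_term x y p =
     (real p)\<^sup>2 / ((x * (real p)\<^sup>2 - real p + 1) * (y * (real p)\<^sup>2 - real p + 1))"

lemma secant_term_nonneg:
  assumes "1/4 < x" "1/4 < y" "prime p"
  shows "0 \<le> secant_term x y p"
  using denominator_pos[of x p] denominator_pos[of y p] assms
  by (simp add: secant_term_def)

text \<open>A bound uniform in \<open>x\<close> and \<open>y\<close> on each half-line \<open>[a, \<infinity>)\<close>, so that it serves both for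
  summability and as a Lipschitz constant.\<close>

lemma secant_term_le:
  assumes a: "1/4 < a" and x: "a \<le> x" and y: "a \<le> y" and p: "prime p"
  shows "secant_term x y p \<le> 1 / (a - 1/4)\<^sup>2 * (1 / (real p)\<^sup>2)"
proof -
  have p0: "0 < real p"
    using p prime_gt_0_nat by simp
  have pos: "0 < (a - 1/4) * (real p)\<^sup>2"
    using a p0 by simp
  have le: "(a - 1/4) * (real p)\<^sup>2 \<le> z * (real p)\<^sup>2 - real p + 1" if "a \<le> z" for z
  proof -
    have "(a - 1/4) * (real p)\<^sup>2 \<le> (z - 1/4) * (real p)\<^sup>2"
      using that by (intro mult_right_mono) auto
    then show ?thesis
      using denominator_ge[of z "real p"] by linarith
  qed
  have "secant_term x y p \<le> (real p)\<^sup>2 / (((a - 1/4) * (real p)\<^sup>2) * ((a - 1/4) * (real p)\<^sup>2))"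
    unfolding secant_term_def
  proof (rule divide_left_mono)
    show "(a - 1/4) * (real p)\<^sup>2 * ((a - 1/4) * (real p)\<^sup>2)
        \<le> (x * (real p)\<^sup>2 - real p + 1) * (y * (real p)\<^sup>2 - real p + 1)"
      by (rule mult_mono[OF le[OF x] le[OF y]]) (use le[OF x] pos in linarith)+
    show "0 < (x * (real p)\<^sup>2 - real p + 1) * (y * (real p)\<^sup>2 - real p + 1)
        * ((a - 1/4) * (real p)\<^sup>2 * ((a - 1/4) * (real p)\<^sup>2))"
      by (rule mult_pos_pos[OF mult_pos_pos mult_pos_pos[OF pos pos]])
        (use le[OF x] le[OF y] pos in linarith)+
  qed simp
  also have "\<dots> = 1 / (a - 1/4)\<^sup>2 * (1 / (real p)\<^sup>2)"
    using p0 by (simp add: power2_eq_square del: diff_divide_distrib)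
  finally show ?thesis .
qed

lemma secant_term_summable:
  assumes "1/4 < x" "1/4 < y"
  shows "secant_term x y summable_on {p. prime p}"
proof (rule summable_on_comparison_test)
  show "(\<lambda>p::nat. 1 / (min x y - 1/4)\<^sup>2 * (1 / (real p)\<^sup>2)) summable_on {p. prime p}"
    by (intro summable_on_cmult_right inverse_squares_summable_on)
next
  fix p :: nat
  assume "p \<in> {p. prime p}"
  then have p: "prime p" by simp
  show "secant_term x y p \<le> 1 / (min x y - 1/4)\<^sup>2 * (1 / (real p)\<^sup>2)"
    using assms p by (intro secant_term_le) auto
  show "0 \<le> secant_term x y p"
    using assms p by (intro secant_term_nonneg)
qed

lemma h_diff:
  assumes x: "1/4 < x" and y: "1/4 < y"
  shows "h x - h y = (y - x) * infsum (secant_term x y) {p. prime p}"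
proof -
  have "h x = (\<Sum>\<^sub>\<infinity>p\<in>{p::nat. prime p}.
      1 / (y * (real p)\<^sup>2 - real p + 1) + (y - x) * secant_term x y p)"
    unfolding h_def
  proof (rule infsum_cong)
    fix p :: nat
    assume "p \<in> {p. prime p}"
    then have "x * (real p)\<^sup>2 - real p + 1 \<noteq> 0" "y * (real p)\<^sup>2 - real p + 1 \<noteq> 0"
      using denominator_pos[OF x, of p] denominator_pos[OF y, of p] by auto
    then show "1 / (x * (real p)\<^sup>2 - real p + 1) =
        1 / (y * (real p)\<^sup>2 - real p + 1) + (y - x) * secant_term x y p"
      unfolding secant_term_def by (simp add: divide_simps) (simp add: algebra_simps)
  qed
  also have "\<dots> = h y + (\<Sum>\<^sub>\<infinity>p\<in>{p::nat. prime p}. (y - x) * secant_term x y p)"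
    unfolding h_def using assms
    by (intro infsum_add h_summable summable_on_cmult_right secant_term_summable)
  finally show ?thesis
    by (simp add: infsum_cmult_right')
qed

text \<open>Only the term \<open>p = 2\<close> of the secant slope is kept: it is already large enough for the
  numerical estimate.\<close>

lemma h_secant_ge:
  assumes x: "1/4 < x" and y: "x \<le> y"
  shows "4 * (y - x) / ((4 * x - 1) * (4 * y - 1)) \<le> h x - h y"
proof -
  have y': "1/4 < y" using x y by simp
  have "sum (secant_term x y) {2} \<le> infsum (secant_term x y) {p. prime p}"
    by (rule finite_sum_le_infsum[OF secant_term_summable[OF x y']])
      (simp_all add: secant_term_nonneg[OF x y'])
  moreover have "secant_term x y 2 = 4 / ((4 * x - 1) * (4 * y - 1))"
    by (simp add: secant_term_def mult.commute)
  ultimately have "(y - x) * (4 / ((4 * x - 1) * (4 * y - 1))) \<le> h x - h y"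
    unfolding h_diff[OF x y'] using y by (intro mult_left_mono) auto
  then show ?thesis by (simp add: mult.commute)
qed

lemma h_strict_antimono:
  assumes "1/4 < x" "x < y"
  shows "h y < h x"
proof -
  have "0 < 4 * (y - x) / ((4 * x - 1) * (4 * y - 1))"
    using assms by (intro divide_pos_pos mult_pos_pos) auto
  then show ?thesis
    using h_secant_ge[of x y] assms by linarith
qed

lemma continuous_on_h:
  assumes a: "1/4 < a"
  shows "continuous_on {a..} h"
proof (rule lipschitz_on_continuous_on)
  let ?L = "1 / (a - 1/4)\<^sup>2 * infsum (\<lambda>p::nat. 1 / (real p)\<^sup>2) {p. prime p}"
  show "?L-lipschitz_on {a..} h"
  proof (rule lipschitz_onI)
    fix x y
    assume "x \<in> {a..}" "y \<in> {a..}"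
    then have xy: "a \<le> x" "a \<le> y" "1/4 < x" "1/4 < y"
      using a by auto
    let ?S = "infsum (secant_term x y) {p. prime p}"
    have "0 \<le> ?S"
      using xy by (intro infsum_nonneg secant_term_nonneg) auto
    moreover have "?S \<le> ?L"
      unfolding infsum_cmult_right'[symmetric] using secant_term_le[OF a] xy
      by (intro infsum_mono secant_term_summable summable_on_cmult_right
          inverse_squares_summable_on) auto
    ultimately have "\<bar>y - x\<bar> * \<bar>?S\<bar> \<le> \<bar>y - x\<bar> * ?L"
      by (intro mult_left_mono) auto
    then show "dist (h x) (h y) \<le> ?L * dist x y"
      using xy by (simp add: dist_real_def h_diff abs_mult abs_minus_commute mult.commute)
  next
    show "0 \<le> ?L"
      by (intro mult_nonneg_nonneg infsum_nonneg) auto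
  qed
qed

lemma lambda_infty_eqI:
  assumes x: "1/4 < x" and hx: "h x = 1"
  shows "lambda_infty = x"
  unfolding lambda_infty_def
proof (rule the_equality)
  show "x \<in> {1/4<..} \<and> h x = 1"
    using assms by simp
next
  fix z
  assume "z \<in> {1/4<..} \<and> h z = 1"
  then show "z = x"
    using h_strict_antimono[of x z] h_strict_antimono[of z x] x hx
    by (cases z x rule: linorder_cases) auto
qed

text \<open>The general principle behind the digit count: a residual smaller than the change of \<open>h\<close>
  guaranteed over distance \<open>\<delta>\<close> traps the root within \<open>\<delta>\<close>. The bound \<open>u\<close> on the
  arguments keeps the contribution of the prime \<open>2\<close> to the steepness at least
  \<open>4 / (4 * u - 1)\<^sup>2\<close>.\<close>

lemma lambda_infty_close:
  assumes \<delta>: "0 < \<delta>" and low: "1/4 < k - \<delta>" and up: "k + \<delta> \<le> u"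
    and res: "\<bar>h k - 1\<bar> < 4 * \<delta> / (4 * u - 1)\<^sup>2"
  shows "\<bar>k - lambda_infty\<bar> < \<delta>"
proof -
  have drop: "4 * \<delta> / (4 * u - 1)\<^sup>2 \<le> h x - h (x + \<delta>)" if x: "1/4 < x" "x + \<delta> \<le> u" for x
  proof -
    have "4 * \<delta> / (4 * u - 1)\<^sup>2 \<le> 4 * \<delta> / ((4 * x - 1) * (4 * (x + \<delta>) - 1))"
      unfolding power2_eq_square using x \<delta>
      by (intro divide_left_mono mult_mono mult_pos_pos) auto
    then show ?thesis
      using h_secant_ge[of x "x + \<delta>"] x \<delta> by simp
  qed
  have left: "1 < h (k - \<delta>)"
    using drop[of "k - \<delta>"] low up \<delta> res by simp
  have right: "h (k + \<delta>) < 1"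
    using drop[of k] low up \<delta> res by simp
  have "continuous_on {k - \<delta>..k + \<delta>} h"
    by (rule continuous_on_subset[OF continuous_on_h[OF low]]) auto
  then obtain x where x: "k - \<delta> \<le> x" "x \<le> k + \<delta>" "h x = 1"
    using IVT2'[of h "k + \<delta>" 1 "k - \<delta>"] left right \<delta> by auto
  have "x \<noteq> k - \<delta>" "x \<noteq> k + \<delta>"
    using x(3) left right by auto
  moreover have "lambda_infty = x"
    using x low by (intro lambda_infty_eqI) auto
  ultimately show ?thesis
    using x by (simp add: abs_less_iff)
qed

text \<open>Reading off the first three digits; the other 497 contribute at most a geometric tail of
  nines.\<close>

lemma lambda_known_bounds: "0.674 \<le> lambda_known" "lambda_known \<le> 0.675"
proof -
  define f where "f i = real (known_digits ! i) / 10 ^ (i + 1)" for i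
  have "lambda_known = sum f ({..<3} \<union> {3..<500})"
    unfolding lambda_known_def f_def by (intro sum.cong) auto
  also have "\<dots> = sum f {..<3} + sum f {3..<500}"
    by (intro sum.union_disjoint) auto
  also have "sum f {..<3} = 0.674"
    by (simp add: f_def known_digits_def numeral_3_eq_3)
  finally have eq: "lambda_known = 0.674 + sum f {3..<500}" .
  have "0 \<le> sum f {3..<500}"
    by (intro sum_nonneg) (simp add: f_def)
  with eq show "0.674 \<le> lambda_known" by simp
  \<comment> \<open>A digit 9 contributes \<open>9 / 10 ^ (i + 1) = 1 / 10 ^ i - 1 / 10 ^ (i + 1)\<close>, which telescopes.\<close>
  have tail: "(\<Sum>i = 3..<n. 1 / 10 ^ i - 1 / 10 ^ Suc i) \<le> (0.001 :: real)"
    if "3 \<le> n" for n :: nat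
    using sum_Suc_diff'[OF that, of "\<lambda>i. - (1 / 10 ^ i :: real)"]
    by simp
  have "sum f {3..<500} \<le> (\<Sum>i = 3..<500. 1 / 10 ^ i - 1 / 10 ^ Suc i)"
  proof (rule sum_mono)
    fix i :: nat
    assume "i \<in> {3..<500}"
    then have "known_digits ! i \<le> 9"
      using known_digits_decimal by (simp add: nth_mem)
    then show "f i \<le> 1 / 10 ^ i - 1 / 10 ^ Suc i"
      by (simp add: f_def field_simps)
  qed
  also have "\<dots> \<le> 0.001"
    by (rule tail) simp
  finally show "lambda_known \<le> 0.675"
    using eq by simp
qed

text \<open>Since \<open>0.17 > 1/6\<close>, this follows from \<open>1/10 < 0.688\<^sup>6\<close>.\<close>

lemma residual_bound_less: "10 powr (- 500.17) < 6.88 * (10 :: real) powr (- 501)"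
proof -
  have "(10 :: real) powr (- 0.17) \<le> 10 powr (- 1/6)"
    by (intro powr_mono) auto
  also have "\<dots> < 0.688"
  proof (rule power_less_imp_less_base)
    have "((10 :: real) powr (- 1/6)) ^ 6 = 10 powr (- 1)"
      by (simp add: powr_power)
    also have "\<dots> < 0.688 ^ 6"
      by (simp add: powr_minus power_divide)
    finally show "((10 :: real) powr (- 1/6)) ^ 6 < 0.688 ^ 6" .
  qed simp
  finally have "(10 :: real) powr (- 0.17) < 0.688" .
  moreover have "(10 :: real) powr (- 500.17) = 10 * 10 powr (- 0.17) * 10 powr (- 501)"
  proof -
    have "(10 :: real) powr (- 500.17) = 10 powr (1 + (- 0.17) + (- 501))"
      by simp
    also have "\<dots> = 10 powr 1 * 10 powr (- 0.17) * 10 powr (- 501)"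
      unfolding powr_add ..
    finally show ?thesis by simp
  qed
  ultimately show ?thesis by simp
qed

theorem proposition7p1:
  assumes "\<bar>h lambda_known - 1\<bar> \<le> 10 powr (- 500.17)"
  shows "\<bar>lambda_known - lambda_infty\<bar> < 5 * 10 powr (- 501)"
proof -
  define e :: real where "e = 10 powr (- 501)"
  have pos: "0 < e"
    unfolding e_def by (rule powr_gt_zero[THEN iffD2]) simp
  have "e \<le> 10 powr (- 4)"
    unfolding e_def by (intro powr_mono) auto
  also have "(10 :: real) powr (- 4) = 0.0001"
    by (simp add: powr_minus)
  finally have small: "e \<le> 0.0001" .
  have "\<bar>lambda_known - lambda_infty\<bar> < 5 * e"
  proof (rule lambda_infty_close[where u = "0.676"])
    show "0 < 5 * e"
      using pos by simp
    show "1/4 < lambda_known - 5 * e"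
      using small lambda_known_bounds by simp
    show "lambda_known + 5 * e \<le> 0.676"
      using small lambda_known_bounds by simp
    have "\<bar>h lambda_known - 1\<bar> < 6.88 * e"
      using assms residual_bound_less unfolding e_def by (rule order.strict_trans1)
    also have "\<dots> \<le> 4 * (5 * e) / (4 * 0.676 - 1)\<^sup>2"
      using pos by (simp add: power2_eq_square)
    finally show "\<bar>h lambda_known - 1\<bar> < 4 * (5 * e) / (4 * 0.676 - 1)\<^sup>2" .
  qed
  then show ?thesis
    unfolding e_def .
qed

end
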